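(* Let $n\ge 1$ be an integer, let $h\in L^1_{\mathrm{loc}}(\mathbb{R})$, let $t_0,c\in\mathbb{R}$, let $a_k,b_k\in\mathbb{R}$ for $k=0,\dots,n-1$, and let $a_n=0$, $b_n=1$. Consider the problem $$Lu:=\sum_{k=0}^n\left[a_k\,u^{(k)}(-t)+b_k\,u^{(k)}(t)\right]=h(t),\ t\in\mathbb{R};\qquad u(t_0)=c. \quad (P)$$ Assume that there exist functions $\tilde u$ and $\tilde v$ satisfying $$\sum_{i=0}^{n-j}\binom{i+j}{j}\left[(-1)^{n+i-1}a_{i+j}\,\tilde u^{(i)}(-t)+b_{i+j}\,\tilde u^{(i)}(t)\right]=0,\quad t\in\mathbb{R};\ j=0,\dots,n-1,$$ $$\sum_{i=0}^{n-j}\binom{i+j}{j}\left[(-1)^{n+i}a_{i+j}\,\tilde v^{(i)}(-t)+b_{i+j}\,\tilde v^{(i)}(t)\right]=0,\quad t\in\mathbb{R};\ j=0,\dots,n-1,$$ $$(\tilde u_e\tilde v_e-\tilde u_o\tilde v_o)(t)\neq 0,\quad t\in\mathbb{R},$$ and also one of the following: (h1) $L\tilde u=0$ and $\tilde u(t_0)\ne0$; (h2) $L\tilde v=0$ and $\tilde v(t_0)\neq 0$; (h3) $a_0+b_0\neq0$ and $$(a_0+b_0)\int_0^{t_0}(t_0-s)^{n-1}\,\frac{\tilde v(t_0)\tilde u_e(s)-\tilde u(t_0)\tilde v_o(s)}{(\tilde u_e\tilde v_e-\tilde u_o\tilde v_o)(s)}\,ds\neq 1.$$ Then problem (P) has a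 solution.
   Context: For a function $f:\mathbb{R}\to\mathbb{R}$, the even and odd parts are $f_e(x)=\frac{f(x)+f(-x)}{2}$ and $f_o(x)=\frac{f(x)-f(-x)}{2}$. A solution of (P) is a function $u\in W^{n,1}_{\mathrm{loc}}(\mathbb{R})$ (its distributional derivatives up to order $n$ are integrable on every compact set $K\subset\mathbb{R}$) satisfying the equation and the condition $u(t_0)=c$. The symbol $f^{(k)}(-t)$ denotes the $k$-th derivative of $f$ at $-t$. *)

theory Defs
  imports "HOL-Analysis.Analysis"
begin

definition even_part :: "(real \<Rightarrow> real) \<Rightarrow> real \<Rightarrow> real" where
  "even_part f x = (f x + f (- x)) / 2"

definition odd_part :: "(real \<Rightarrow> real) \<Rightarrow> real \<Rightarrow> real" where
  "odd_part f x = (f x - f (- x)) / 2"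

definition derivs :: "(real \<Rightarrow> real) \<Rightarrow> nat \<Rightarrow> real \<Rightarrow> real" where
  "derivs f k = (deriv ^^ k) f"

definition times_differentiable :: "nat \<Rightarrow> (real \<Rightarrow> real) \<Rightarrow> bool" where
  "times_differentiable n f \<longleftrightarrow> (\<forall>k<n. \<forall>t. derivs f k differentiable (at t))"

definition locally_integrable :: "(real \<Rightarrow> real) \<Rightarrow> bool" where
  "locally_integrable f \<longleftrightarrow> (\<forall>K. compact K \<longrightarrow> f absolutely_integrable_on K)"

definition test_function :: "(real \<Rightarrow> real) \<Rightarrow> bool" where
  "test_function \<phi> \<longleftrightarrow> (\<forall>n. times_differentiable n \<phi>) \<and> compact (closure {x. \<phi> x \<noteq> 0})"

text \<open>The distributional derivative of order \<open>k\<close> of \<open>u\<close> is (represented by) the locally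
  integrable function \<open>g\<close>.\<close>

definition has_weak_deriv :: "nat \<Rightarrow> (real \<Rightarrow> real) \<Rightarrow> (real \<Rightarrow> real) \<Rightarrow> bool" where
  "has_weak_deriv k u g \<longleftrightarrow> locally_integrable u \<and> locally_integrable g \<and>
     (\<forall>\<phi>. test_function \<phi> \<longrightarrow>
        (LINT x|lebesgue. u x * derivs \<phi> k x) = (-1) ^ k * (LINT x|lebesgue. g x * \<phi> x))"

definition sobolev_loc :: "nat \<Rightarrow> (real \<Rightarrow> real) \<Rightarrow> bool" where
  "sobolev_loc n u \<longleftrightarrow> (\<forall>k\<le>n. \<exists>g. has_weak_deriv k u g)"

text \<open>The operator \<open>L\<close>, applied to a family \<open>d\<close> where \<open>d k\<close> is the derivative of order \<open>k\<close>
  (classical or distributional) of the function in question.\<close>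

definition reflection_op ::
  "nat \<Rightarrow> (nat \<Rightarrow> real) \<Rightarrow> (nat \<Rightarrow> real) \<Rightarrow> (nat \<Rightarrow> real \<Rightarrow> real) \<Rightarrow> real \<Rightarrow> real" where
  "reflection_op n a b d t = (\<Sum>k=0..n. a k * d k (- t) + b k * d k t)"

text \<open>For \<open>n \<ge> 1\<close> every class in the local Sobolev space has a unique continuous representative,
  and the point condition \<open>u t0 = c\<close> refers to it; hence the continuity requirement, without which
  that condition would be void. The family \<open>g\<close> is determined by \<open>u\<close> up to null sets.\<close>

definition is_solution ::
  "nat \<Rightarrow> (nat \<Rightarrow> real) \<Rightarrow> (nat \<Rightarrow> real) \<Rightarrow> (real \<Rightarrow> real) \<Rightarrow> real \<Rightarrow> real \<Rightarrow> (real \<Rightarrow> real) \<Rightarrow> bool" where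
  "is_solution n a b h t0 c u \<longleftrightarrow>
     continuous_on UNIV u \<and> sobolev_loc n u \<and>
     (\<exists>g. (\<forall>k\<le>n. has_weak_deriv k u (g k)) \<and>
          (AE t in lebesgue. reflection_op n a b g t = h t)) \<and>
     u t0 = c"

end

theory Submission
  imports Defs
begin

text \<open>The idea is to look for a solution \<open>u = ut \<Phi> + vt \<Psi>\<close> with \<open>\<Phi>\<close> even and \<open>\<Psi>\<close>
  odd. For a factor of known parity, \<open>\<Phi>\<^sup>(\<^sup>j\<^sup>) (- t)\<close> is a signed \<open>\<Phi>\<^sup>(\<^sup>j\<^sup>) t\<close>, so the Leibniz rule
  expresses \<open>L (ut \<Phi>)\<close> through the derivatives of \<open>\<Phi>\<close> at \<open>t\<close> alone. The system for
  \<open>ut\<close> makes all their coefficients vanish except the leading one, and likewise for \<open>vt\<close>;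
  hence \<open>L u = ut \<Phi>\<^sup>(\<^sup>n\<^sup>) + vt \<Psi>\<^sup>(\<^sup>n\<^sup>)\<close> (lemma \<open>reflection_op_product_deriv\<close>). Since the parities
  of \<open>\<Phi>\<^sup>(\<^sup>n\<^sup>)\<close> and \<open>\<Psi>\<^sup>(\<^sup>n\<^sup>)\<close> are opposite, the equation \<open>L u = h\<close>, read at \<open>t\<close> and \<open>- t\<close>, is a
  linear system with determinant a multiple of
  \<open>ut\<^sub>e vt\<^sub>e - ut\<^sub>o vt\<^sub>o\<close>; it is solved by locally integrable functions
  (\<open>parity_splitting\<close>), and \<open>\<Phi>\<close>, \<open>\<Psi>\<close> are their iterated primitives from 0, up to a
  polynomial of the right parity.

  The systems carry the sign \<open>(-1) ^ (n + i - 1)\<close> at \<open>a (i + j)\<close>, whereas the Leibniz rule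
  produces \<open>(-1) ^ j\<close>. These differ when \<open>n - (i + j)\<close> is even, but the existence of \<open>ut\<close>
  and \<open>vt\<close> forces those coefficients \<open>a (i + j)\<close> to be 0: the two systems, evaluated at
  \<open>t = 0\<close>, determine all \<open>a k\<close> and \<open>b k\<close> (\<open>reflection_coefficient_eq_0\<close>).

  For the condition at \<open>t0\<close> a solution of the homogeneous equation with nonzero value there is
  needed. By the above \<open>ut\<close> is a homogeneous solution, and for \<open>n \<ge> 2\<close> so is
  \<open>t vt t\<close>; the determinant prevents both from vanishing at \<open>t0\<close>. For \<open>n = 1\<close> each of the
  three alternatives gives \<open>ut t0 \<noteq> 0\<close>: the second forces \<open>a 0 = 0\<close>, so that \<open>ut\<close> is an
  exponential, and in the third the integral term would equal 1 if \<open>ut t0\<close> were 0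
  (\<open>first_order_integral_eq_1\<close>).

  Regularity is handled by the relation \<open>is_primitive\<close> of local absolute continuity, which is
  closed under products (\<open>is_primitive_mult\<close>) and yields weak derivatives through integration
  by parts (\<open>has_weak_deriv_of_primitives\<close>).\<close>

section \<open>Locally integrable functions and their primitives\<close>

lemma locally_integrable_interval:
  assumes "locally_integrable f"
  shows "f absolutely_integrable_on {x..y}" "f integrable_on {x..y}"
  using assms unfolding locally_integrable_def
  by (auto intro: set_lebesgue_integral_eq_integral(1))

lemma locally_integrableI:
  assumes "\<And>x y. f absolutely_integrable_on {x..y}"
  shows "locally_integrable f"
  unfolding locally_integrable_def
proof (intro allI impI)
  fix K :: "real set" assume K: "compact K"
  obtain x y where "K \<subseteq> {x..y}"
    using compact_imp_bounded[OF K] bounded_subset_cbox_symmetric by (metis box_real(2))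
  then show "f absolutely_integrable_on K"
    using assms[of x y] K by (meson lmeasurable_compact fmeasurableD set_integrable_subset)
qed

lemma locally_integrable_add:
  "locally_integrable f \<Longrightarrow> locally_integrable g \<Longrightarrow> locally_integrable (\<lambda>t. f t + g t)"
  unfolding locally_integrable_def by (auto intro: set_integral_add)

lemma locally_integrable_mult_continuous:
  assumes f: "locally_integrable f" and g: "continuous_on UNIV g"
  shows "locally_integrable (\<lambda>t. g t * f t)"
proof (rule locally_integrableI)
  fix x y :: real
  have "continuous_on {x..y} g" using g continuous_on_subset by blast
  then show "(\<lambda>t. g t * f t) absolutely_integrable_on {x..y}"
    by (intro absolutely_integrable_bounded_measurable_product_real locally_integrable_interval f)
      (auto intro!: continuous_imp_measurable_on_sets_lebesgue compact_imp_bounded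
          compact_continuous_image)
qed

lemma locally_integrable_continuous:
  "continuous_on UNIV g \<Longrightarrow> locally_integrable g"
  by (intro locally_integrableI absolutely_integrable_continuous_real)
    (auto intro: continuous_on_subset)

lemma locally_integrable_reflect:
  assumes "locally_integrable f" shows "locally_integrable (\<lambda>t. f (- t))"
proof (rule locally_integrableI)
  fix x y :: real
  show "(\<lambda>t. f (- t)) absolutely_integrable_on {x..y}"
    using absolutely_integrable_reflect_real[where f = f and a = "- y" and b = "- x"]
      locally_integrable_interval(1)[OF assms] by simp
qed

text \<open>The equality on all intervals says that \<open>F\<close> is locally absolutely continuous with almost
  everywhere derivative \<open>f\<close>. Stating it through the integral avoids any differentiation of
  \<open>F\<close>, and gives exactly what integration by parts consumes.\<close>

definition is_primitive :: "(real \<Rightarrow> real) \<Rightarrow> (real \<Rightarrow> real) \<Rightarrow> bool" where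
  "is_primitive F f \<longleftrightarrow> locally_integrable f \<and>
     (\<forall>x y. x \<le> y \<longrightarrow> (f has_integral (F y - F x)) {x..y})"

lemma is_primitiveD:
  assumes "is_primitive F f"
  shows "locally_integrable f" "x \<le> y \<Longrightarrow> (f has_integral (F y - F x)) {x..y}"
  using assms unfolding is_primitive_def by auto

lemma is_primitive_continuous:
  assumes "is_primitive F f" shows "continuous_on UNIV F"
proof -
  have "isCont F t" for t
  proof -
    have "continuous_on {t-1..t+1} (\<lambda>x. F (t-1) + integral {t-1..x} f)"
      by (intro continuous_intros indefinite_integral_continuous_1 locally_integrable_interval
          is_primitiveD(1)[OF assms])
    then have "continuous_on {t-1..t+1} F"
      by (rule continuous_on_eq) (use is_primitiveD(2)[OF assms] in \<open>force simp: integral_unique\<close>)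
    then show ?thesis by (rule continuous_on_interior) auto
  qed
  then show ?thesis by (simp add: continuous_at_imp_continuous_on)
qed

lemma is_primitive_of_derivative:
  assumes "\<And>t. (F has_real_derivative f t) (at t)" "continuous_on UNIV f"
  shows "is_primitive F f"
  unfolding is_primitive_def
  using assms by (auto intro!: locally_integrable_continuous fundamental_theorem_of_calculus
      simp: has_real_derivative_iff_has_vector_derivative[symmetric] has_field_derivative_at_within)

lemma is_primitive_add:
  assumes "is_primitive F f" "is_primitive G g"
  shows "is_primitive (\<lambda>t. F t + G t) (\<lambda>t. f t + g t)"
  using assms unfolding is_primitive_def
  by (auto intro: locally_integrable_add has_integral_add simp: add_diff_add)

lemma is_primitive_cmult:
  assumes "is_primitive F f" shows "is_primitive (\<lambda>t. c * F t) (\<lambda>t. c * f t)"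
  using assms unfolding is_primitive_def
  by (auto intro!: locally_integrable_mult_continuous has_integral_mult_right
      simp: right_diff_distrib[symmetric])

lemma is_primitive_sum:
  assumes "finite I" "\<And>i. i \<in> I \<Longrightarrow> is_primitive (F i) (f i)"
  shows "is_primitive (\<lambda>t. \<Sum>i\<in>I. F i t) (\<lambda>t. \<Sum>i\<in>I. f i t)"
  using assms
proof (induction I rule: finite_induct)
  case empty
  show ?case by (simp add: is_primitive_def locally_integrable_continuous)
next
  case (insert i I)
  then show ?case by (simp add: is_primitive_add)
qed

text \<open>The product rule for absolutely continuous functions. On a short interval \<open>{a..b}\<close>,
  \<open>F b * G b - F a * G a = (F b - F a) * G b + F a * (G b - G a)\<close>, so the error
  \<open>F b * G b - F a * G a - integral {a..b} (f G + F g)\<close> is the integral of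
  \<open>(G b - G t) f t - (F t - F a) g t\<close>. By continuity of \<open>F\<close> and \<open>G\<close> its size is at most \<open>e\<close> times the
  integral of \<open>\<bar>f\<bar> + \<bar>g\<bar>\<close>. Error and bound are additive over adjacent intervals, so Bolzano's principle
  extends the bound to every interval; then let \<open>e\<close> tend to 0.\<close>

lemma is_primitive_mult:
  assumes F: "is_primitive F f" and G: "is_primitive G g"
  shows "is_primitive (\<lambda>t. F t * G t) (\<lambda>t. f t * G t + F t * g t)"
proof -
  have cF: "continuous_on UNIV F" and cG: "continuous_on UNIV G"
    using F G by (auto intro: is_primitive_continuous)
  have lf: "locally_integrable f" and lg: "locally_integrable g"
    using F G by (auto dest: is_primitiveD)
  let ?h = "\<lambda>t. G t * f t + F t * g t"
  have lh: "locally_integrable ?h"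
    by (intro locally_integrable_add locally_integrable_mult_continuous cF cG lf lg)
  have labs: "locally_integrable (\<lambda>t. \<bar>f t\<bar> + \<bar>g t\<bar>)"
    using lf lg unfolding locally_integrable_def
    by (auto intro!: set_integral_add set_integrable_abs)
  have main: "F y * G y - F x * G x = integral {x..y} ?h" if xy: "x \<le> y" for x y
  proof -
    define E where "E a b = \<bar>F b * G b - F a * G a - integral {a..b} ?h\<bar>" for a b
    define A where "A a b = integral {a..b} (\<lambda>t. \<bar>f t\<bar> + \<bar>g t\<bar>)" for a b
    have bound: "E x y \<le> e * A x y" if e: "e > 0" for e
      using xy
    proof (rule Bolzano)
      fix a b c :: real assume ab: "E a b \<le> e * A a b" and bc: "E b c \<le> e * A b c"
        and le: "a \<le> b" "b \<le> c"
      have "E a c \<le> E a b + E b c"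
        unfolding E_def using Henstock_Kurzweil_Integration.integral_combine[OF le locally_integrable_interval(2)[OF lh]]
        by linarith
      also have "\<dots> \<le> e * (A a b + A b c)" using ab bc by (simp add: algebra_simps)
      also have "A a b + A b c = A a c"
        unfolding A_def by (rule Henstock_Kurzweil_Integration.integral_combine[OF le locally_integrable_interval(2)[OF labs]])
      finally show "E a c \<le> e * A a c" .
    next
      fix z :: real assume "x \<le> z" "z \<le> y"
      have "isCont F z" "isCont G z" using cF cG by (auto simp: continuous_on_eq_continuous_at)
      then obtain d1 d2 where d: "d1 > 0" "d2 > 0"
        "\<And>w. \<bar>w - z\<bar> < d1 \<Longrightarrow> \<bar>F w - F z\<bar> < e/2" "\<And>w. \<bar>w - z\<bar> < d2 \<Longrightarrow> \<bar>G w - G z\<bar> < e/2"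
        unfolding continuous_at_eps_delta dist_real_def using e by (metis half_gt_zero)
      show "\<exists>d>0. \<forall>a b. a \<le> z \<and> z \<le> b \<and> b - a < d \<longrightarrow> E a b \<le> e * A a b"
      proof (intro exI[of _ "min d1 d2"] conjI allI impI)
        fix a b assume ab: "a \<le> z \<and> z \<le> b \<and> b - a < min d1 d2"
        have near: "\<bar>G b - G s\<bar> \<le> e" "\<bar>F s - F a\<bar> \<le> e" if "s \<in> {a..b}" for s
        proof -
          have "\<bar>s - z\<bar> < min d1 d2" "\<bar>a - z\<bar> < min d1 d2" "\<bar>b - z\<bar> < min d1 d2"
            using ab that by auto
          then show "\<bar>G b - G s\<bar> \<le> e" "\<bar>F s - F a\<bar> \<le> e"
            using d(3)[of s] d(3)[of a] d(4)[of s] d(4)[of b] by linarith+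
        qed
        have hi: "(f has_integral (F b - F a)) {a..b}" "(g has_integral (G b - G a)) {a..b}"
          using ab is_primitiveD[OF F] is_primitiveD[OF G] by auto
        have "((\<lambda>t. G b * f t + F a * g t - ?h t) has_integral
             (G b * (F b - F a) + F a * (G b - G a) - integral {a..b} ?h)) {a..b}"
          by (intro has_integral_diff has_integral_add has_integral_mult_right hi
              integrable_integral locally_integrable_interval lh)
        then have I: "((\<lambda>t. (G b - G t) * f t - (F t - F a) * g t) has_integral
             (F b * G b - F a * G a - integral {a..b} ?h)) {a..b}"
          by (simp add: algebra_simps)
        have "norm (F b * G b - F a * G a - integral {a..b} ?h)
            \<le> integral {a..b} (\<lambda>t. e * (\<bar>f t\<bar> + \<bar>g t\<bar>))"
          unfolding integral_unique[OF I, symmetric]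
        proof (rule integral_norm_bound_integral)
          show "(\<lambda>t. (G b - G t) * f t - (F t - F a) * g t) integrable_on {a..b}" using I by blast
          show "(\<lambda>t. e * (\<bar>f t\<bar> + \<bar>g t\<bar>)) integrable_on {a..b}"
            by (intro integrable_on_mult_right locally_integrable_interval labs)
          fix t assume t: "t \<in> {a..b}"
          have "\<bar>(G b - G t) * f t - (F t - F a) * g t\<bar> \<le> \<bar>G b - G t\<bar> * \<bar>f t\<bar> + \<bar>F t - F a\<bar> * \<bar>g t\<bar>"
            by (metis abs_mult abs_triangle_ineq4)
          also have "\<dots> \<le> e * \<bar>f t\<bar> + e * \<bar>g t\<bar>"
            using near[OF t] by (intro add_mono mult_right_mono) auto
          finally show "norm ((G b - G t) * f t - (F t - F a) * g t) \<le> e * (\<bar>f t\<bar> + \<bar>g t\<bar>)"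
            by (simp add: algebra_simps)
        qed
        then show "E a b \<le> e * A a b" unfolding E_def A_def by simp
      qed (use d in auto)
    qed
    have A0: "A x y \<ge> 0" unfolding A_def by (rule integral_nonneg) (auto intro: locally_integrable_interval labs)
    have "E x y \<le> 0 + e" if "e > 0" for e
    proof -
      \<comment> \<open>The 1 in the denominator covers the case \<open>A x y = 0\<close>.\<close>
      have "E x y \<le> e / (A x y + 1) * A x y" using bound[of "e / (A x y + 1)"] A0 that by simp
      also have "\<dots> \<le> e" using A0 that by (simp add: field_simps)
      finally show ?thesis by simp
    qed
    then have "E x y \<le> 0" by (rule field_le_epsilon)
    then show ?thesis unfolding E_def by simp
  qed
  have "is_primitive (\<lambda>t. F t * G t) ?h"
    unfolding is_primitive_def using lh main locally_integrable_interval(2)[OF lh]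
    by (auto simp: has_integral_integral)
  then show ?thesis by (simp add: mult.commute)
qed

text \<open>At least one of the two intervals is empty or a point, so this is the oriented integral from 0 to
  \<open>t\<close>. Starting at 0 makes taking primitives exchange even and odd functions.\<close>

definition primitive :: "(real \<Rightarrow> real) \<Rightarrow> real \<Rightarrow> real" where
  "primitive f t = integral {0..t} f - integral {t..0} f"

lemma is_primitive_primitive:
  assumes f: "locally_integrable f" shows "is_primitive (primitive f) f"
  unfolding is_primitive_def
proof (intro conjI allI impI f)
  fix x y :: real assume xy: "x \<le> y"
  note ii = locally_integrable_interval(2)[OF f]
  note comb = Henstock_Kurzweil_Integration.integral_combine[OF _ _ ii]
  have pos: "integral {t..0} f = 0" if "0 \<le> t" for t using that by (cases "t = 0") auto
  have neg: "integral {0..t} f = 0" if "t \<le> 0" for t using that by (cases "t = 0") auto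
  consider "0 \<le> x" | "x \<le> 0" "0 \<le> y" | "y \<le> 0" using xy by linarith
  then have "primitive f y - primitive f x = integral {x..y} f"
    unfolding primitive_def
    by cases (use xy comb[of 0 x y] comb[of x 0 y] comb[of x y 0] pos neg in auto)
  then show "(f has_integral primitive f y - primitive f x) {x..y}"
    using ii by (simp add: has_integral_integral)
qed

lemma primitive_parity:
  assumes "\<And>t. f (- t) = \<sigma> * f t" shows "primitive f (- t) = - \<sigma> * primitive f t"
proof -
  have "integral {-b..-a} f = \<sigma> * integral {a..b} f" for a b
    using Henstock_Kurzweil_Integration.integral_reflect_real[of b a "\<lambda>x. f (- x)"]
    by (simp add: assms)
  from this[of t 0] this[of 0 t] show ?thesis by (simp add: primitive_def algebra_simps)
qed

section \<open>Weak derivatives\<close>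

lemma derivs_Suc: "derivs f (Suc k) = deriv (derivs f k)"
  by (simp add: derivs_def)

lemma derivs_0 [simp]: "derivs f 0 = f"
  by (simp add: derivs_def)

lemma times_differentiable_derivs:
  assumes "times_differentiable n f" "k < n"
  shows "(derivs f k has_real_derivative derivs f (Suc k) t) (at t)"
  using assms unfolding times_differentiable_def derivs_Suc
  by (metis DERIV_deriv_iff_real_differentiable)

lemma test_function_derivs:
  assumes "test_function \<phi>"
  shows "(derivs \<phi> k has_real_derivative derivs \<phi> (Suc k) t) (at t)"
  using assms times_differentiable_derivs[of "Suc k" \<phi> k] by (simp add: test_function_def)

text \<open>A single bound serves all derivatives, because each of them vanishes on the open complement
  of the support of \<open>\<phi>\<close>.\<close>

lemma test_function_support:
  assumes "test_function \<phi>"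
  obtains R where "R > 0" "\<And>k t. \<bar>t\<bar> \<ge> R \<Longrightarrow> derivs \<phi> k t = 0"
proof -
  let ?S = "closure {x. \<phi> x \<noteq> 0}"
  have "bounded ?S" using assms by (auto simp: test_function_def compact_imp_bounded)
  then obtain R where R: "R > 0" "\<And>x. x \<in> ?S \<Longrightarrow> \<bar>x\<bar> \<le> R" by (auto simp: bounded_pos)
  have "derivs \<phi> k t = 0" if "t \<notin> ?S" for k t
    using that
  proof (induction k arbitrary: t)
    case 0
    then show ?case using closure_subset[of "{x. \<phi> x \<noteq> 0}"] by auto
  next
    case (Suc k)
    have "open (- ?S)" by auto
    have "(derivs \<phi> k has_real_derivative 0) (at t)"
      by (rule has_field_derivative_transform_within_open[where S = "- ?S" and f = "\<lambda>_. 0"])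
        (use Suc in auto)
    then show ?case by (simp add: derivs_Suc DERIV_imp_deriv)
  qed
  with R show thesis by (intro that[of "R + 1"]) (auto, fastforce)
qed

text \<open>The product \<open>G \<cdot> \<phi>\<close> is absolutely continuous and vanishes at both ends of an
  interval that contains the support of \<open>\<phi>\<close>, so the integral of its derivative is 0.\<close>

lemma primitive_by_parts:
  assumes G: "is_primitive G g" and \<phi>: "test_function \<phi>"
  shows "(LINT x|lebesgue. G x * derivs \<phi> (Suc k) x) = - (LINT x|lebesgue. g x * derivs \<phi> k x)"
proof -
  obtain R where R: "R > 0" "\<And>k t. \<bar>t\<bar> \<ge> R \<Longrightarrow> derivs \<phi> k t = 0"
    using test_function_support[OF \<phi>] by blast
  have cont: "continuous_on UNIV (derivs \<phi> k)" for k
    using test_function_derivs[OF \<phi>] by (meson DERIV_continuous_on DERIV_subset subset_UNIV)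
  have to_interval: "(LINT x|lebesgue. f x * derivs \<phi> k x) = integral {-R..R} (\<lambda>x. f x * derivs \<phi> k x)"
    if f: "locally_integrable f" for f k
  proof -
    have "locally_integrable (\<lambda>x. derivs \<phi> k x * f x)"
      by (intro locally_integrable_mult_continuous f cont)
    then have "(\<lambda>x. f x * derivs \<phi> k x) absolutely_integrable_on {-R..R}"
      by (simp add: locally_integrable_interval mult.commute)
    then have "(LINT x:{-R..R}|lebesgue. f x * derivs \<phi> k x) = integral {-R..R} (\<lambda>x. f x * derivs \<phi> k x)"
      by (rule set_lebesgue_integral_eq_integral(2))
    moreover have "indicator {-R..R} x *\<^sub>R (f x * derivs \<phi> k x) = f x * derivs \<phi> k x" for x
      using R(2)[of x k] by (cases "\<bar>x\<bar> \<ge> R") (auto simp: indicator_def)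
    ultimately show ?thesis by (simp only: set_lebesgue_integral_def)
  qed
  have P: "is_primitive (\<lambda>t. G t * derivs \<phi> k t) (\<lambda>t. g t * derivs \<phi> k t + G t * derivs \<phi> (Suc k) t)"
    by (intro is_primitive_mult G is_primitive_of_derivative test_function_derivs \<phi> cont)
  have lg: "locally_integrable (\<lambda>x. derivs \<phi> k x * g x)" "locally_integrable (\<lambda>x. derivs \<phi> (Suc k) x * G x)"
    by (intro locally_integrable_mult_continuous is_primitiveD(1)[OF G] cont
        locally_integrable_continuous is_primitive_continuous[OF G])+
  have "0 = integral {-R..R} (\<lambda>t. g t * derivs \<phi> k t + G t * derivs \<phi> (Suc k) t)"
    using is_primitiveD(2)[OF P, of "-R" R] R(1) R(2)[of R] R(2)[of "-R"] by (simp add: integral_unique)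
  also have "\<dots> = integral {-R..R} (\<lambda>t. g t * derivs \<phi> k t) + integral {-R..R} (\<lambda>t. G t * derivs \<phi> (Suc k) t)"
    using lg[THEN locally_integrable_interval(2)]
    by (intro Henstock_Kurzweil_Integration.integral_add) (simp_all add: mult.commute)
  finally show ?thesis
    by (simp add: to_interval is_primitiveD(1)[OF G] locally_integrable_continuous is_primitive_continuous[OF G])
qed

text \<open>Move the derivatives from the test function to \<open>d 0\<close> one at a time. At \<open>k = 0\<close> the
  local integrability of \<open>d 0\<close> comes from its continuity, for which \<open>d 0\<close> has to be a
  primitive, that is, \<open>n \<ge> 1\<close>.\<close>

lemma has_weak_deriv_of_primitives:
  assumes "\<And>k. k < n \<Longrightarrow> is_primitive (d k) (d (Suc k))" "n \<ge> 1" "k \<le> n"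
  shows "has_weak_deriv k (d 0) (d k)"
proof -
  have li: "locally_integrable (d i)" if "i \<le> n" for i
  proof (cases i)
    case 0
    then show ?thesis
      using assms(1)[of 0] assms(2) by (auto intro: locally_integrable_continuous is_primitive_continuous)
  next
    case (Suc j)
    then show ?thesis using assms(1)[of j] that by (auto dest: is_primitiveD(1))
  qed
  have "(LINT x|lebesgue. d 0 x * derivs \<phi> k x) = (-1) ^ i * (LINT x|lebesgue. d i x * derivs \<phi> (k - i) x)"
    if \<phi>: "test_function \<phi>" and "i \<le> k" for \<phi> i
    using that(2)
  proof (induction i)
    case (Suc i)
    have "k - i = Suc (k - Suc i)" using Suc by auto
    then have "(LINT x|lebesgue. d i x * derivs \<phi> (k - i) x) = - (LINT x|lebesgue. d (Suc i) x * derivs \<phi> (k - Suc i) x)"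
      using primitive_by_parts[OF assms(1)[of i] \<phi>, of "k - Suc i"] Suc assms(3) by simp
    then show ?case using Suc by simp
  qed simp
  from this[of _ k] show ?thesis unfolding has_weak_deriv_def using li assms by simp
qed

section \<open>The Leibniz rule and the reflection operator\<close>

lemma Leibniz_sum_Suc:
  fixes f g :: "nat \<Rightarrow> real"
  shows "(\<Sum>j\<le>Suc k. real (Suc k choose j) * (f (Suc k - j) * g j)) =
    (\<Sum>j\<le>k. real (k choose j) * (f (Suc (k - j)) * g j + f (k - j) * g (Suc j)))"
proof -
  define x where "x j = f (Suc k - j) * g j" for j
  have "(\<Sum>j\<le>Suc k. real (Suc k choose j) * x j)
      = (\<Sum>j\<le>k. real (k choose j) * x (Suc j)) + (x 0 + (\<Sum>j\<le>k. real (k choose Suc j) * x (Suc j)))"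
    by (subst sum.atMost_Suc_shift) (simp add: sum.distrib algebra_simps)
  also have "x 0 + (\<Sum>j\<le>k. real (k choose Suc j) * x (Suc j)) = (\<Sum>j\<le>Suc k. real (k choose j) * x j)"
    by (subst sum.atMost_Suc_shift) simp
  also have "\<dots> = (\<Sum>j\<le>k. real (k choose j) * x j)" by simp
  finally have "(\<Sum>j\<le>Suc k. real (Suc k choose j) * x j) = (\<Sum>j\<le>k. real (k choose j) * (x j + x (Suc j)))"
    by (simp add: sum.distrib algebra_simps)
  also have "\<dots> = (\<Sum>j\<le>k. real (k choose j) * (f (Suc (k - j)) * g j + f (k - j) * g (Suc j)))"
    by (intro sum.cong) (auto simp: x_def Suc_diff_le)
  finally show ?thesis by (simp add: x_def)
qed

text \<open>The Leibniz expression for the derivative of order \<open>k\<close> of a product, where the families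
  \<open>U\<close> and \<open>\<Phi>\<close> list the successive derivatives of the two factors. Families are used
  because the last member of \<open>\<Phi>\<close> will be merely locally integrable.\<close>

definition product_deriv ::
  "(nat \<Rightarrow> real \<Rightarrow> real) \<Rightarrow> (nat \<Rightarrow> real \<Rightarrow> real) \<Rightarrow> nat \<Rightarrow> real \<Rightarrow> real" where
  "product_deriv U \<Phi> k t = (\<Sum>j\<le>k. real (k choose j) * (U (k - j) t * \<Phi> j t))"

lemma is_primitive_product_deriv:
  assumes "\<And>k. k < n \<Longrightarrow> is_primitive (U k) (U (Suc k))"
    and "\<And>k. k < n \<Longrightarrow> is_primitive (\<Phi> k) (\<Phi> (Suc k))" and "k < n"
  shows "is_primitive (product_deriv U \<Phi> k) (product_deriv U \<Phi> (Suc k))"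
proof -
  have "is_primitive (\<lambda>t. \<Sum>j\<le>k. real (k choose j) * (U (k - j) t * \<Phi> j t))
     (\<lambda>t. \<Sum>j\<le>k. real (k choose j) * (U (Suc (k - j)) t * \<Phi> j t + U (k - j) t * \<Phi> (Suc j) t))"
    using assms by (intro is_primitive_sum is_primitive_cmult is_primitive_mult) auto
  then show ?thesis
    unfolding product_deriv_def[abs_def]
    by (simp only: Leibniz_sum_Suc[of k "\<lambda>i. U i t" "\<lambda>j. \<Phi> j t" for t])
qed

text \<open>If \<open>\<Phi> 0\<close> is even (\<open>\<sigma> = 1\<close>) or odd (\<open>\<sigma> = -1\<close>), every \<open>\<Phi> j (- t)\<close> is a
  signed \<open>\<Phi> j t\<close>. Expanding \<open>L\<close> by the Leibniz rule and collecting the coefficient of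
  \<open>\<Phi> j t\<close> then yields the left-hand side of the condition on \<open>U\<close> for \<open>j < n\<close>, which
  is 0, and \<open>U 0 t\<close> for \<open>j = n\<close>. Multiplication by \<open>U 0\<close> thus turns \<open>L\<close> into the plain
  derivative of order \<open>n\<close>.\<close>

lemma reflection_op_product_deriv:
  assumes parity: "\<And>j. j \<le> n \<Longrightarrow> \<Phi> j (- t) = \<sigma> * (-1) ^ j * \<Phi> j t"
    and cond: "\<And>j. j < n \<Longrightarrow>
      (\<Sum>i=0..n-j. real ((i + j) choose j) *
         (\<sigma> * (-1) ^ j * a (i + j) * U i (- t) + b (i + j) * U i t)) = 0"
    and an: "a n = 0" and bn: "b n = 1"
  shows "reflection_op n a b (product_deriv U \<Phi>) t = U 0 t * \<Phi> n t"
proof -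
  define g where "g j i = real ((i + j) choose j) *
      (\<sigma> * (-1) ^ j * a (i + j) * U i (- t) + b (i + j) * U i t) * \<Phi> j t" for j i
  have "reflection_op n a b (product_deriv U \<Phi>) t = (\<Sum>k\<le>n. \<Sum>j\<le>k. g j (k - j))"
    unfolding reflection_op_def product_deriv_def atLeast0AtMost sum_distrib_left sum.distrib[symmetric]
    by (intro sum.cong refl) (auto simp: g_def parity algebra_simps)
  also have "\<dots> = (\<Sum>(j,i) | j + i \<le> n. g j i)" by (rule sum.triangle_reindex_eq[symmetric])
  also have "{(j,i). j + i \<le> n} = (SIGMA j:{..n}. {0..n - j})" by auto
  also have "(\<Sum>(j,i)\<in>(SIGMA j:{..n}. {0..n - j}). g j i) = (\<Sum>j\<le>n. \<Sum>i=0..n-j. g j i)"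
    by (rule sum.Sigma[symmetric]) auto
  also have "\<dots> = (\<Sum>j\<le>n. if j = n then U 0 t * \<Phi> n t else 0)"
  proof (intro sum.cong refl)
    fix j assume "j \<in> {..n}"
    show "(\<Sum>i=0..n-j. g j i) = (if j = n then U 0 t * \<Phi> n t else 0)"
    proof (cases "j = n")
      case True
      then show ?thesis by (simp add: g_def an bn)
    next
      case False
      then have "j < n" using \<open>j \<in> {..n}\<close> by simp
      have "(\<Sum>i=0..n-j. g j i) = 0 * \<Phi> j t"
        unfolding g_def sum_distrib_right[symmetric] cond[OF \<open>j < n\<close>] ..
      then show ?thesis using False by simp
    qed
  qed
  also have "\<dots> = U 0 t * \<Phi> n t" by simp
  finally show ?thesis .
qed

section \<open>The coefficients of the operator\<close>

text \<open>The product \<open>q p q p \<cdots>\<close> with \<open>i\<close> factors: the values at 0 of the successive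
  derivatives of a solution of \<open>u' t = \<alpha> u t + \<beta> u (- t)\<close> with \<open>u 0 = 1\<close>, for
  \<open>q = \<alpha> + \<beta>\<close> and \<open>p = \<alpha> - \<beta>\<close>.\<close>

primrec alternating_product :: "real \<Rightarrow> real \<Rightarrow> nat \<Rightarrow> real" where
  "alternating_product p q 0 = 1"
| "alternating_product p q (Suc i) = alternating_product p q i * (if even i then q else p)"

lemma alternating_product_add:
  "alternating_product p q (m + i) =
    (if even i then alternating_product p q m else alternating_product q p m) * alternating_product p q i"
  by (induction m) auto

lemma alternating_product_even:
  assumes "even m" shows "alternating_product p q m = alternating_product q p m"
proof -
  have "alternating_product p q (2 * r) = (p * q) ^ r" for p q r by (induction r) auto
  with assms show ?thesis by (auto simp: mult.commute elim!: evenE)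
qed

text \<open>The equation for index \<open>j\<close> contains \<open>c j\<close> once, in the term \<open>i = 0\<close>, and otherwise
  only coefficients of larger index. Inserting their values, all alternating products combine to
  the one of length \<open>n - j\<close>, the binomial coefficients to \<open>n choose j\<close> times
  \<open>(n - j) choose i\<close>, and the remaining sum is an alternating sum of binomial coefficients
  without its first term, hence \<open>-1\<close>.\<close>

lemma triangular_step:
  fixes p q :: real and c c' :: "nat \<Rightarrow> real"
  assumes "j < n"
    and c: "\<And>k. j < k \<Longrightarrow> k \<le> n \<Longrightarrow> c k = (-1) ^ (n - k) * real (n choose k) * alternating_product p q (n - k)"
    and c': "\<And>k. j < k \<Longrightarrow> k \<le> n \<Longrightarrow> c' k = (-1) ^ (n - k) * real (n choose k) * alternating_product q p (n - k)"
    and eq: "(\<Sum>i=0..n-j. real ((i + j) choose j) *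
       ((if even i then c (i + j) else c' (i + j)) * alternating_product p q i)) = 0"
  shows "c j = (-1) ^ (n - j) * real (n choose j) * alternating_product p q (n - j)"
proof -
  define m where "m = n - j"
  have m: "m > 0" "n = m + j" using assms(1) by (auto simp: m_def)
  define K where "K = (-1) ^ m * real (n choose j) * alternating_product p q m"
  have "real ((i + j) choose j) * ((if even i then c (i + j) else c' (i + j)) * alternating_product p q i)
     = K * ((-1) ^ i * real (m choose i))" if i: "i \<in> {1..m}" for i
  proof -
    define r where "r = m - i"
    have r: "m = r + i" "n - (i + j) = r" using i m by (auto simp: r_def)
    have ch: "real ((i + j) choose j) * real (n choose (i + j)) = real (n choose j) * real (m choose i)"
      using choose_mult[of j "i + j" n] i m by (simp flip: of_nat_mult add: mult.commute)
    have "(if even i then c (i + j) else c' (i + j)) * alternating_product p q i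
        = (-1) ^ r * real (n choose (i + j)) * alternating_product p q m"
      using i m c[of "i + j"] c'[of "i + j"] alternating_product_add[of p q r i] r by auto
    moreover have "(-1::real) ^ r = (-1) ^ m * (-1) ^ i"
      unfolding r(1) power_add by (simp flip: power_mult_distrib)
    ultimately show ?thesis using ch by (simp add: K_def)
  qed
  then have "(\<Sum>i=1..m. real ((i + j) choose j) * ((if even i then c (i + j) else c' (i + j)) * alternating_product p q i))
     = K * (\<Sum>i=1..m. (-1) ^ i * real (m choose i))"
    by (simp add: sum_distrib_left)
  moreover have "(\<Sum>i=1..m. (-1) ^ i * real (m choose i)) = -1"
    using choose_alternating_sum[OF m(1), where 'a = real]
    by (simp add: atMost_atLeast0 sum.atLeast_Suc_atMost)
  ultimately have "c j - K = 0"
    using eq unfolding m_def[symmetric] by (simp add: sum.atLeast_Suc_atMost)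
  then show ?thesis by (simp add: K_def m_def)
qed

text \<open>Both systems of the theorem at once: \<open>\<sigma> = 1\<close> is the one for \<open>ut\<close> and \<open>\<sigma> = -1\<close>
  the one for \<open>vt\<close>. The sign \<open>(-1) ^ (n + i - 1)\<close> is written as \<open>- (-1) ^ (n + i)\<close> to avoid
  subtraction of natural numbers.\<close>

definition reflection_factor ::
  "nat \<Rightarrow> (nat \<Rightarrow> real) \<Rightarrow> (nat \<Rightarrow> real) \<Rightarrow> real \<Rightarrow> (real \<Rightarrow> real) \<Rightarrow> bool" where
  "reflection_factor n a b \<sigma> u \<longleftrightarrow> times_differentiable n u \<and>
     (\<forall>j<n. \<forall>t. (\<Sum>i=0..n-j. real ((i + j) choose j) *
         (- \<sigma> * (-1) ^ (n + i) * a (i + j) * derivs u i (- t) + b (i + j) * derivs u i t)) = 0)"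

text \<open>This is the condition for \<open>j = n - 1\<close>, which has only two terms.\<close>

lemma reflection_factor_first_order:
  assumes u: "reflection_factor n a b \<sigma> u" and n: "n \<ge> 1" and an: "a n = 0" and bn: "b n = 1"
  shows "derivs u 1 t = - b (n - 1) / n * u t + \<sigma> * (-1) ^ n * a (n - 1) / n * u (- t)"
proof -
  obtain m where m: "n = Suc m" using n by (cases n) auto
  have "(\<Sum>i=0..n-m. real ((i + m) choose m) *
         (- \<sigma> * (-1) ^ (n + i) * a (i + m) * derivs u i (- t) + b (i + m) * derivs u i t)) = 0"
    using u m unfolding reflection_factor_def by blast
  then have "real n * derivs u 1 t = - b (n - 1) * u t + \<sigma> * (-1) ^ n * a (n - 1) * u (- t)"
    using an bn by (simp add: m algebra_simps)
  then have "derivs u 1 t = (- b (n - 1) * u t + \<sigma> * (-1) ^ n * a (n - 1) * u (- t)) / n"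
    using n by (simp add: eq_divide_eq mult.commute)
  then show ?thesis by (simp add: diff_divide_distrib)
qed

lemma reflection_factor_derivs_Suc:
  assumes u: "reflection_factor n a b \<sigma> u" and n: "n \<ge> 1" and an: "a n = 0" and bn: "b n = 1"
    and "i < n"
  shows "derivs u (Suc i) t = - b (n - 1) / n * derivs u i t
     + (-1) ^ i * (\<sigma> * (-1) ^ n * a (n - 1) / n) * derivs u i (- t)"
  using \<open>i < n\<close>
proof (induction i arbitrary: t)
  case 0
  then show ?case using reflection_factor_first_order[OF u n an bn] by simp
next
  case (Suc i)
  define al be where "al = - b (n - 1) / n" and "be = \<sigma> * (-1) ^ n * a (n - 1) / n"
  have IH: "derivs u (Suc i) = (\<lambda>t. al * derivs u i t + (-1) ^ i * be * derivs u i (- t))"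
    using Suc by (auto simp: al_def be_def)
  have D: "(derivs u i has_real_derivative derivs u (Suc i) s) (at s)" for s
    using u Suc by (intro times_differentiable_derivs[of n]) (auto simp: reflection_factor_def)
  have "((\<lambda>s. derivs u i (- s)) has_real_derivative - derivs u (Suc i) (- t)) (at t)"
    using D[of "- t"] by (subst (asm) DERIV_mirror)
  then have "((\<lambda>s. al * derivs u i s + (-1) ^ i * be * derivs u i (- s)) has_real_derivative
      al * derivs u (Suc i) t + (-1) ^ i * be * - derivs u (Suc i) (- t)) (at t)"
    by (intro DERIV_add DERIV_cmult D)
  then have "(derivs u (Suc i) has_real_derivative
      al * derivs u (Suc i) t + (-1) ^ i * be * - derivs u (Suc i) (- t)) (at t)"
    by (simp only: IH[symmetric])
  then have "derivs u (Suc (Suc i)) t = al * derivs u (Suc i) t + (-1) ^ Suc i * be * derivs u (Suc i) (- t)"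
    by (simp add: derivs_Suc DERIV_imp_deriv)
  then show ?case by (simp add: al_def be_def)
qed

text \<open>The recurrence expresses each derivative by the previous one, so the derivative of order
  \<open>n\<close> is continuous although only its existence is assumed.\<close>

lemma reflection_factor_is_primitive:
  assumes u: "reflection_factor n a b \<sigma> u" and n: "n \<ge> 1" and an: "a n = 0" and bn: "b n = 1"
    and "i < n"
  shows "is_primitive (derivs u i) (derivs u (Suc i))"
proof -
  have D: "(derivs u i has_real_derivative derivs u (Suc i) s) (at s)" for s
    using u \<open>i < n\<close> by (intro times_differentiable_derivs[of n]) (auto simp: reflection_factor_def)
  then have c: "continuous_on UNIV (derivs u i)"
    by (meson DERIV_continuous_on DERIV_subset subset_UNIV)
  have "continuous_on UNIV (\<lambda>t. - b (n - 1) / n * derivs u i t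
     + (-1) ^ i * (\<sigma> * (-1) ^ n * a (n - 1) / n) * derivs u i (- t))"
    by (intro continuous_intros c continuous_on_compose2[OF c]) auto
  then have "continuous_on UNIV (derivs u (Suc i))"
    using reflection_factor_derivs_Suc[OF u n an bn \<open>i < n\<close>] by (simp add: ext)
  with D show ?thesis by (rule is_primitive_of_derivative)
qed

lemma reflection_factor_derivs_at_0:
  assumes u: "reflection_factor n a b \<sigma> u" and n: "n \<ge> 1" and an: "a n = 0" and bn: "b n = 1"
    and "i \<le> n"
  defines "al \<equiv> - b (n - 1) / n" and "be \<equiv> \<sigma> * (-1) ^ n * a (n - 1) / n"
  shows "derivs u i 0 = u 0 * alternating_product (al - be) (al + be) i"
  using \<open>i \<le> n\<close>
proof (induction i)
  case (Suc i)
  have "derivs u (Suc i) 0 = (al + (-1) ^ i * be) * derivs u i 0"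
    using reflection_factor_derivs_Suc[OF u n an bn, of i 0] Suc(2)
    by (simp add: al_def be_def algebra_simps)
  then show ?case using Suc by (auto simp: algebra_simps)
qed simp

lemma reflection_factor_equation_at_0:
  assumes u: "reflection_factor n a b \<sigma> u" and n: "n \<ge> 1" and an: "a n = 0" and bn: "b n = 1"
    and u0: "u 0 \<noteq> 0" and "j < n"
  defines "al \<equiv> - b (n - 1) / n" and "be \<equiv> \<sigma> * (-1) ^ n * a (n - 1) / n"
  shows "(\<Sum>i=0..n-j. real ((i + j) choose j) *
      ((if even i then b (i + j) - \<sigma> * (-1) ^ n * a (i + j) else b (i + j) + \<sigma> * (-1) ^ n * a (i + j))
        * alternating_product (al - be) (al + be) i)) = 0"
proof -
  have "(\<Sum>i=0..n-j. real ((i + j) choose j) *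
         (- \<sigma> * (-1) ^ (n + i) * a (i + j) * derivs u i (- 0) + b (i + j) * derivs u i 0)) = 0"
    using u \<open>j < n\<close> unfolding reflection_factor_def by blast
  also have "(\<Sum>i=0..n-j. real ((i + j) choose j) *
         (- \<sigma> * (-1) ^ (n + i) * a (i + j) * derivs u i (- 0) + b (i + j) * derivs u i 0))
     = u 0 * (\<Sum>i=0..n-j. real ((i + j) choose j) *
      ((if even i then b (i + j) - \<sigma> * (-1) ^ n * a (i + j) else b (i + j) + \<sigma> * (-1) ^ n * a (i + j))
        * alternating_product (al - be) (al + be) i))"
    unfolding sum_distrib_left
    by (intro sum.cong refl)
      (use \<open>j < n\<close> in \<open>auto simp: reflection_factor_derivs_at_0[OF u n an bn, folded al_def be_def]
        power_add algebra_simps\<close>)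
  finally show ?thesis using u0 by simp
qed

text \<open>The key to the sign pattern of the two systems. Evaluated at 0, where neither \<open>u\<close> nor
  \<open>v\<close> vanishes, the two systems are triangular linear equations for the combinations
  \<open>b k - (-1) ^ n * a k\<close> and \<open>b k + (-1) ^ n * a k\<close>. Their solutions are the products
  \<open>q p q \<cdots>\<close> and \<open>p q p \<cdots>\<close> of length \<open>n - k\<close>, up to the same factor. For even length the
  two products coincide, and \<open>a k\<close>, half of the difference up to sign, is 0.\<close>

lemma reflection_coefficient_eq_0:
  assumes u: "reflection_factor n a b 1 u" and v: "reflection_factor n a b (-1) v"
    and n: "n \<ge> 1" and an: "a n = 0" and bn: "b n = 1"
    and u0: "u 0 \<noteq> 0" and v0: "v 0 \<noteq> 0" and "k \<le> n" "even (n - k)"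
  shows "a k = 0"
proof -
  define al be where "al = - b (n - 1) / n" and "be = (-1) ^ n * a (n - 1) / n"
  define w where "w = alternating_product (al - be) (al + be)"
  define w' where "w' = alternating_product (al + be) (al - be)"
  define c where "c k = b k - (-1) ^ n * a k" for k
  define c' where "c' k = b k + (-1) ^ n * a k" for k
  have eqs: "(\<Sum>i=0..n-j. real ((i + j) choose j) * ((if even i then c (i + j) else c' (i + j)) * w i)) = 0"
    "(\<Sum>i=0..n-j. real ((i + j) choose j) * ((if even i then c' (i + j) else c (i + j)) * w' i)) = 0"
    if "j < n" for j
    using reflection_factor_equation_at_0[OF u n an bn u0 that]
      reflection_factor_equation_at_0[OF v n an bn v0 that]
    by (simp_all add: c_def c'_def al_def be_def w_def w'_def cong: if_cong)
  have "c j = (-1) ^ (n - j) * real (n choose j) * w (n - j) \<and>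
        c' j = (-1) ^ (n - j) * real (n choose j) * w' (n - j)" if "j \<le> n" for j
    using that
  proof (induction "n - j" arbitrary: j rule: less_induct)
    case less
    show ?case
    proof (cases "j = n")
      case True
      then show ?thesis by (simp add: c_def c'_def an bn w_def w'_def)
    next
      case False
      then have j: "j < n" using less.prems by simp
      have IH: "c k = (-1) ^ (n - k) * real (n choose k) * w (n - k)"
        "c' k = (-1) ^ (n - k) * real (n choose k) * w' (n - k)" if "j < k" "k \<le> n" for k
        using less.hyps[of k] that by auto
      show ?thesis
        using triangular_step[OF j IH[unfolded w_def w'_def] eqs(1)[OF j, unfolded w_def]]
          triangular_step[OF j IH(2,1)[unfolded w_def w'_def] eqs(2)[OF j, unfolded w'_def]]
        by (simp add: w_def w'_def)
    qed
  qed
  then have "c k = c' k"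
    using \<open>k \<le> n\<close> alternating_product_even[OF \<open>even (n - k)\<close>] by (simp add: w_def w'_def)
  then show ?thesis by (simp add: c_def c'_def)
qed

text \<open>Apart from the common factor \<open>\<sigma>\<close>, the Leibniz rule needs the sign \<open>(-1) ^ j\<close> and the
  systems carry \<open>- (-1) ^ (n + i)\<close>. The two agree when \<open>n - (i + j)\<close> is odd, and otherwise the coefficient
  \<open>a (i + j)\<close> is 0.\<close>

lemma reflection_factor_Leibniz_condition:
  assumes u: "reflection_factor n a b \<sigma> u" and "j < n"
    and a0: "\<And>k. k \<le> n \<Longrightarrow> even (n - k) \<Longrightarrow> a k = 0"
  shows "(\<Sum>i=0..n-j. real ((i + j) choose j) *
     (\<sigma> * (-1) ^ j * a (i + j) * derivs u i (- t) + b (i + j) * derivs u i t)) = 0"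
proof -
  have sign: "\<sigma> * (-1) ^ j * a (i + j) = - \<sigma> * (-1) ^ (n + i) * a (i + j)" if "i \<in> {0..n-j}" for i
  proof (cases "even (n - (i + j))")
    case True
    moreover have "i + j \<le> n" using that \<open>j < n\<close> by auto
    ultimately show ?thesis using a0[of "i + j"] by (simp only: mult_zero_right)
  next
    case False
    moreover have "n + i = n - (i + j) + 2 * i + j" using that \<open>j < n\<close> by auto
    ultimately have "even (n + i) \<longleftrightarrow> odd j" by (metis dvd_triv_left even_add)
    then have "(-1::real) ^ j = - ((-1) ^ (n + i))" by (auto simp: minus_one_power_iff)
    then show ?thesis by (simp only: mult_minus_left mult_minus_right)
  qed
  have "(\<Sum>i=0..n-j. real ((i + j) choose j) *
     (\<sigma> * (-1) ^ j * a (i + j) * derivs u i (- t) + b (i + j) * derivs u i t))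
    = (\<Sum>i=0..n-j. real ((i + j) choose j) *
     (- \<sigma> * (-1) ^ (n + i) * a (i + j) * derivs u i (- t) + b (i + j) * derivs u i t))"
    by (intro sum.cong refl) (simp only: sign)
  then show ?thesis using u \<open>j < n\<close> unfolding reflection_factor_def by auto
qed

section \<open>Solving the equation\<close>

lemma is_solution_of_derivative_chain:
  assumes n: "n \<ge> 1" and d: "\<And>k. k < n \<Longrightarrow> is_primitive (d k) (d (Suc k))"
    and L: "\<And>t. reflection_op n a b d t = h t"
  shows "is_solution n a b h t0 (d 0 t0) (d 0)"
proof -
  have w: "has_weak_deriv k (d 0) (d k)" if "k \<le> n" for k
    by (rule has_weak_deriv_of_primitives[of n d]) (use d n that in auto)
  have "continuous_on UNIV (d 0)" using d[of 0] n by (auto intro: is_primitive_continuous)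
  moreover have "sobolev_loc n (d 0)" using w by (auto simp: sobolev_loc_def)
  ultimately show ?thesis unfolding is_solution_def using w L by blast
qed

definition iterated_primitive :: "(real \<Rightarrow> real) \<Rightarrow> nat \<Rightarrow> real \<Rightarrow> real" where
  "iterated_primitive f m = (primitive ^^ m) f"

lemma iterated_primitive_simps [simp]:
  "iterated_primitive f 0 = f"
  "iterated_primitive f (Suc m) = primitive (iterated_primitive f m)"
  by (simp_all add: iterated_primitive_def)

lemma locally_integrable_iterated_primitive:
  assumes "locally_integrable f" shows "locally_integrable (iterated_primitive f m)"
  by (induction m) (use assms in \<open>auto intro!: locally_integrable_continuous
      is_primitive_continuous[OF is_primitive_primitive]\<close>)

lemma iterated_primitive_parity:
  assumes "\<And>t. f (- t) = \<sigma> * f t"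
  shows "iterated_primitive f m (- t) = \<sigma> * (-1) ^ m * iterated_primitive f m t"
proof (induction m arbitrary: t)
  case (Suc m)
  show ?case using primitive_parity[of "iterated_primitive f m" "\<sigma> * (-1) ^ m" t, OF Suc] by simp
qed (use assms in simp)

lemma is_primitive_iterated_primitive:
  assumes "locally_integrable f" "k < n"
  shows "is_primitive (iterated_primitive f (n - k)) (iterated_primitive f (n - Suc k))"
proof -
  have "n - k = Suc (n - Suc k)" using assms(2) by simp
  then show ?thesis
    by (simp add: is_primitive_primitive locally_integrable_iterated_primitive assms(1))
qed

lemma iterated_primitive_parity_below:
  assumes "\<And>t. f (- t) = \<sigma> * (-1) ^ n * f t" "j \<le> n"
  shows "iterated_primitive f (n - j) (- t) = \<sigma> * (-1) ^ j * iterated_primitive f (n - j) t"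
proof -
  have "(-1::real) ^ n * (-1) ^ (n - j) = (-1) ^ j"
  proof -
    have "n + (n - j) = 2 * (n - j) + j" using assms(2) by simp
    then have "(-1::real) ^ n * (-1) ^ (n - j) = (-1) ^ (2 * (n - j) + j)"
      by (simp only: power_add[symmetric])
    then show ?thesis by (simp add: power_add power_mult)
  qed
  then show ?thesis
    using iterated_primitive_parity[of f "\<sigma> * (-1) ^ n" "n - j" t] assms(1) by (simp add: mult.assoc)
qed

text \<open>Up to sign and a factor 2, the determinant of the linear system that \<open>parity_splitting\<close>
  solves.\<close>

definition cross_det :: "(real \<Rightarrow> real) \<Rightarrow> (real \<Rightarrow> real) \<Rightarrow> real \<Rightarrow> real" where
  "cross_det u v t = even_part u t * even_part v t - odd_part u t * odd_part v t"

lemma cross_det_eq: "cross_det u v t = (u t * v (- t) + u (- t) * v t) / 2"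
  by (simp add: cross_det_def even_part_def odd_part_def field_simps)

text \<open>Because \<open>f\<close> and \<open>g\<close> have prescribed opposite parities, writing \<open>u f + v g = h\<close> at
  \<open>t\<close> and at \<open>- t\<close> gives two linear equations for \<open>f t\<close> and \<open>g t\<close>. The witnesses
  are the result of Cramer's rule; their parities follow from the determinant being even.\<close>

lemma parity_splitting:
  assumes h: "locally_integrable h" and u: "continuous_on UNIV u" and v: "continuous_on UNIV v"
    and det: "\<And>t. cross_det u v t \<noteq> 0" and e: "e * e = 1"
  obtains f g where "locally_integrable f" "locally_integrable g"
    "\<And>t. f (- t) = e * f t" "\<And>t. g (- t) = - e * g t" "\<And>t. u t * f t + v t * g t = h t"
proof
  let ?D = "cross_det u v"
  let ?f = "\<lambda>t. v (- t) / (2 * ?D t) * h t + e * v t / (2 * ?D t) * h (- t)"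
  let ?g = "\<lambda>t. u (- t) / (2 * ?D t) * h t + (- e * u t / (2 * ?D t)) * h (- t)"
  have um: "continuous_on UNIV (\<lambda>t. u (- t))" and vm: "continuous_on UNIV (\<lambda>t. v (- t))"
    by (auto intro!: continuous_intros continuous_on_compose2[OF u] continuous_on_compose2[OF v])
  have D: "continuous_on UNIV ?D"
    unfolding cross_det_eq[abs_def] by (intro continuous_intros u v um vm) auto
  have even: "?D (- t) = ?D t" for t by (simp add: cross_det_eq)
  show "locally_integrable ?f" "locally_integrable ?g"
    by (intro locally_integrable_add locally_integrable_mult_continuous locally_integrable_reflect h
        continuous_intros u v um vm D; simp add: det)+
  show "?f (- t) = e * ?f t" "?g (- t) = - e * ?g t" for t
    using e unfolding square_eq_1_iff by (auto simp: even)
  show "u t * ?f t + v t * ?g t = h t" for t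
  proof -
    have D2: "u t * v (- t) + u (- t) * v t = 2 * ?D t" by (simp add: cross_det_eq)
    have "u t * ?f t + v t * ?g t = h t * (u t * v (- t) + u (- t) * v t) / (2 * ?D t)"
      by (simp add: add_divide_distrib algebra_simps)
    also have "\<dots> = h t" using det[of t] by (simp add: D2)
    finally show ?thesis .
  qed
qed

text \<open>The solution is \<open>u \<Phi> + v \<Psi>\<close> with \<open>\<Phi>\<close> even and \<open>\<Psi>\<close> odd, where the
  derivatives of order \<open>n\<close> of \<open>\<Phi>\<close> and \<open>\<Psi>\<close> are the two parts \<open>f\<close> and \<open>g\<close> of
  \<open>h\<close>. Adding a constant \<open>x\<close> to \<open>\<Phi>\<close>, or for \<open>n \<ge> 2\<close> a linear function \<open>y t\<close> to
  \<open>\<Psi>\<close>, keeps parities and derivatives of order \<open>n\<close>; it changes the value at \<open>t0\<close> by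
  \<open>x u t0\<close> or \<open>y t0 v t0\<close>. One of the two suffices to reach \<open>c\<close>: if \<open>u t0 = 0\<close>, then
  \<open>t0 \<noteq> 0\<close> and \<open>v t0 \<noteq> 0\<close> since the determinant vanishes neither at 0 nor at \<open>t0\<close>.\<close>

lemma problem_solvable:
  assumes n: "n \<ge> 1" and h: "locally_integrable h" and an: "a n = 0" and bn: "b n = 1"
    and u: "reflection_factor n a b 1 u" and v: "reflection_factor n a b (-1) v"
    and det: "\<And>t. cross_det u v t \<noteq> 0"
    and t0: "n \<ge> 2 \<or> u t0 \<noteq> 0"
  shows "\<exists>w. is_solution n a b h t0 c w"
proof -
  have uv0: "u 0 \<noteq> 0" "v 0 \<noteq> 0" using det[of 0] by (auto simp: cross_det_eq)
  have a0: "a k = 0" if "k \<le> n" "even (n - k)" for k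
    using reflection_coefficient_eq_0[OF u v n an bn uv0 that] .
  note prim_u = reflection_factor_is_primitive[OF u n an bn]
  note prim_v = reflection_factor_is_primitive[OF v n an bn]
  have cont: "continuous_on UNIV u" "continuous_on UNIV v"
    using prim_u[of 0] prim_v[of 0] n by (auto dest: is_primitive_continuous)
  obtain f g where lf: "locally_integrable f" and lg: "locally_integrable g"
    and fe: "\<And>t. f (- t) = (-1) ^ n * f t" and ge: "\<And>t. g (- t) = - ((-1) ^ n) * g t"
    and fg: "\<And>t. u t * f t + v t * g t = h t"
    by (rule parity_splitting[OF h cont det, of "(-1) ^ n"]) (auto simp flip: power_mult_distrib)
  \<comment> \<open>If \<open>t0 = 0\<close>, then \<open>u t0 = u 0 \<noteq> 0\<close>.\<close>
  have nz: "u t0 \<noteq> 0 \<or> (n \<ge> 2 \<and> t0 * v t0 \<noteq> 0)"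
    using t0 det[of t0] uv0 by (auto simp: cross_det_eq)
  define r where "r = c - u t0 * iterated_primitive f n t0 - v t0 * iterated_primitive g n t0"
  define x where "x = (if u t0 \<noteq> 0 then r / u t0 else 0)"
  define y where "y = (if u t0 \<noteq> 0 then 0 else r / (t0 * v t0))"
  have y1: "y = 0" if "n = 1" using nz that by (auto simp: y_def)
  define \<Phi> where "\<Phi> j t = iterated_primitive f (n - j) t + x * (if j = 0 then 1 else 0)" for j t
  define \<Psi> where "\<Psi> j t = iterated_primitive g (n - j) t
     + y * (if j = 0 then t else if j = 1 then 1 else 0)" for j t
  have prim_\<Phi>: "is_primitive (\<Phi> k) (\<Phi> (Suc k))" if "k < n" for k
    unfolding \<Phi>_def[abs_def]
    by (intro is_primitive_add is_primitive_cmult is_primitive_iterated_primitive lf that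
        is_primitive_of_derivative) (auto intro!: derivative_eq_intros)
  have prim_\<Psi>: "is_primitive (\<Psi> k) (\<Psi> (Suc k))" if "k < n" for k
    unfolding \<Psi>_def[abs_def]
    by (intro is_primitive_add is_primitive_cmult is_primitive_iterated_primitive lg that
        is_primitive_of_derivative) (auto intro!: derivative_eq_intros)
  have par_\<Phi>: "\<Phi> j (- t) = 1 * (-1) ^ j * \<Phi> j t" if "j \<le> n" for j t
    using iterated_primitive_parity_below[of f 1 n j t] fe that by (simp add: \<Phi>_def)
  have par_\<Psi>: "\<Psi> j (- t) = (-1) * (-1) ^ j * \<Psi> j t" if "j \<le> n" for j t
    using iterated_primitive_parity_below[of g "-1" n j t] ge that
    by (simp add: \<Psi>_def algebra_simps)
  define d where "d k t = product_deriv (derivs u) \<Phi> k t + product_deriv (derivs v) \<Psi> k t" for k t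
  have "is_primitive (d k) (d (Suc k))" if "k < n" for k
    unfolding d_def[abs_def]
    by (intro is_primitive_add is_primitive_product_deriv[OF _ _ that] prim_u prim_v prim_\<Phi> prim_\<Psi>)
  moreover have "reflection_op n a b d t = h t" for t
  proof -
    have Lu: "reflection_op n a b (product_deriv (derivs u) \<Phi>) t = derivs u 0 t * \<Phi> n t"
      by (rule reflection_op_product_deriv[where \<sigma> = 1 and a = a and b = b and n = n, OF _ _ an bn],
          erule par_\<Phi>,
          erule reflection_factor_Leibniz_condition[OF u], erule (1) a0)
    have Lv: "reflection_op n a b (product_deriv (derivs v) \<Psi>) t = derivs v 0 t * \<Psi> n t"
      by (rule reflection_op_product_deriv[where \<sigma> = "-1" and a = a and b = b and n = n, OF _ _ an bn],
          erule par_\<Psi>,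
          erule reflection_factor_Leibniz_condition[OF v], erule (1) a0)
    have "reflection_op n a b d t = reflection_op n a b (product_deriv (derivs u) \<Phi>) t
        + reflection_op n a b (product_deriv (derivs v) \<Psi>) t"
      unfolding reflection_op_def d_def sum.distrib[symmetric]
      by (intro sum.cong refl) (simp add: algebra_simps)
    also have "\<dots> = u t * \<Phi> n t + v t * \<Psi> n t"
      by (simp only: Lu Lv derivs_0)
    also have "\<dots> = h t" using fg[of t] n y1 by (auto simp: \<Phi>_def \<Psi>_def)
    finally show ?thesis .
  qed
  ultimately have "is_solution n a b h t0 (d 0 t0) (d 0)"
    by (rule is_solution_of_derivative_chain[OF n])
  moreover have "d 0 t0 = c"
    using nz by (auto simp: d_def product_deriv_def \<Phi>_def \<Psi>_def x_def y_def r_def field_simps)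
  ultimately show ?thesis by blast
qed

text \<open>For \<open>n = 1\<close> the integral in the third alternative can be evaluated. The determinant is
  constant and \<open>odd_part u\<close> has derivative \<open>- (p + q) * even_part u\<close>, so for \<open>u t0 = 0\<close> the
  integral times \<open>p + q\<close> is \<open>- v t0 * odd_part u t0\<close> over the determinant; at a zero of \<open>u\<close> the even part is
  minus the odd part, and the determinant is that same product.\<close>

lemma first_order_integral_eq_1:
  fixes u v :: "real \<Rightarrow> real" and p q :: real
  assumes u: "\<And>t. (u has_real_derivative (- q * u t - p * u (- t))) (at t)"
    and v: "\<And>t. (v has_real_derivative (- q * v t + p * v (- t))) (at t)"
    and det: "\<And>t. cross_det u v t \<noteq> 0" and t0: "u t0 = 0"
  shows "(p + q) * (LBINT s=0..t0. (v t0 * even_part u s - u t0 * odd_part v s) / cross_det u v s) = 1"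
proof -
  have um: "((\<lambda>s. u (- s)) has_real_derivative q * u (- t) + p * u t) (at t)" for t
    using u[of "- t"] by (subst (asm) DERIV_mirror) (simp add: algebra_simps)
  have vm: "((\<lambda>s. v (- s)) has_real_derivative q * v (- t) - p * v t) (at t)" for t
    using v[of "- t"] by (subst (asm) DERIV_mirror) (simp add: algebra_simps)
  have "(cross_det u v has_real_derivative 0) (at t)" for t
    unfolding cross_det_eq[abs_def]
    by (rule derivative_eq_intros u v um vm refl)+ (simp_all add: algebra_simps)
  then obtain D where D: "\<And>t. cross_det u v t = D" using DERIV_isconst_all by blast
  have D0: "D \<noteq> 0" using det D by metis
  let ?F = "\<lambda>s. - (v t0 / D) * odd_part u s"
  let ?f = "\<lambda>s. (p + q) * ((v t0 * even_part u s - u t0 * odd_part v s) / cross_det u v s)"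
  have odd: "(odd_part u has_real_derivative - (p + q) * even_part u s) (at s)" for s
    unfolding odd_part_def[abs_def] even_part_def
    by (rule DERIV_cong[OF DERIV_cdivide[OF DERIV_diff[OF u um]]]) (simp add: field_simps)
  have "(?F has_real_derivative ?f s) (at s)" for s
    by (rule DERIV_cong[OF DERIV_cmult[OF odd]]) (simp add: D t0 D0 field_simps)
  then have "(?F has_vector_derivative ?f s) (at s within {min 0 t0..max 0 t0})" for s
    by (simp add: has_real_derivative_iff_has_vector_derivative has_vector_derivative_at_within)
  moreover have "continuous_on {min 0 t0..max 0 t0} ?f"
  proof -
    have "continuous_on S u" "continuous_on S (\<lambda>s. u (- s))" for S
      by (rule DERIV_continuous_on, rule has_field_derivative_at_within, rule u um)+
    then show ?thesis unfolding even_part_def D t0 by (auto intro!: continuous_intros simp: D0)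
  qed
  ultimately have "(LBINT s=ereal 0..ereal t0. ?f s) = ?F t0 - ?F 0"
    by (intro interval_integral_FTC_finite)
  also have "\<dots> = 1"
    using D[of t0] D0 t0 by (auto simp: cross_det_eq odd_part_def field_simps)
  finally show ?thesis by (simp only: interval_lebesgue_integral_mult_right zero_ereal_def)
qed

theorem theorem2p1:
  fixes n :: nat and h :: "real \<Rightarrow> real" and t0 c :: real
    and a b :: "nat \<Rightarrow> real" and ut vt :: "real \<Rightarrow> real"
  assumes n: "n \<ge> 1"
    and h: "locally_integrable h"
    and an: "a n = 0" and bn: "b n = 1"
    and ut_diff: "times_differentiable n ut"
    and vt_diff: "times_differentiable n vt"
    and ut: "\<And>j t. j \<le> n - 1 \<Longrightarrow>
      (\<Sum>i=0..n-j. real ((i + j) choose j) *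
         ((-1) ^ (n + i - 1) * a (i + j) * derivs ut i (- t) + b (i + j) * derivs ut i t)) = 0"
    and vt: "\<And>j t. j \<le> n - 1 \<Longrightarrow>
      (\<Sum>i=0..n-j. real ((i + j) choose j) *
         ((-1) ^ (n + i) * a (i + j) * derivs vt i (- t) + b (i + j) * derivs vt i t)) = 0"
    and nonzero: "\<And>t. even_part ut t * even_part vt t - odd_part ut t * odd_part vt t \<noteq> 0"
    and alternatives:
      "((\<forall>t. reflection_op n a b (derivs ut) t = 0) \<and> ut t0 \<noteq> 0) \<or>
       ((\<forall>t. reflection_op n a b (derivs vt) t = 0) \<and> vt t0 \<noteq> 0) \<or>
       (a 0 + b 0 \<noteq> 0 \<and>
        (a 0 + b 0) *
          (LBINT s=0..t0. (t0 - s) ^ (n - 1) *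
             ((vt t0 * even_part ut s - ut t0 * odd_part vt s) /
              (even_part ut s * even_part vt s - odd_part ut s * odd_part vt s))) \<noteq> 1)"
  shows "\<exists>u. is_solution n a b h t0 c u"
proof -
  have sign: "(-1::real) ^ (n + i - 1) = - 1 * (-1) ^ (n + i)" for i
    using n by (cases n) auto
  have U: "reflection_factor n a b 1 ut"
    using ut ut_diff unfolding reflection_factor_def sign by auto
  have V: "reflection_factor n a b (-1) vt"
    using vt vt_diff unfolding reflection_factor_def by auto
  have det: "cross_det ut vt t \<noteq> 0" for t using nonzero[of t] by (simp add: cross_det_def)
  \<comment> \<open>A zero of \<open>ut\<close> at \<open>t0\<close> for \<open>n = 1\<close> excludes the first and third alternatives,
    so \<open>L vt = 0\<close>. Compared at 0 with the system for \<open>vt\<close> this gives \<open>a 0 = 0\<close>;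
    then \<open>ut\<close> is a multiple of an exponential function and has no zero.\<close>
  have "n \<ge> 2 \<or> ut t0 \<noteq> 0"
  proof (rule ccontr)
    assume "\<not> ?thesis"
    then have n1: "n = 1" and t0: "ut t0 = 0" using n by auto
    have du: "(ut has_real_derivative (- b 0 * ut t - a 0 * ut (- t))) (at t)" for t
      using times_differentiable_derivs[OF ut_diff, of 0 t]
        reflection_factor_first_order[OF U n an bn, of t] by (simp add: n1)
    have dv: "(vt has_real_derivative (- b 0 * vt t + a 0 * vt (- t))) (at t)" for t
      using times_differentiable_derivs[OF vt_diff, of 0 t]
        reflection_factor_first_order[OF V n an bn, of t] by (simp add: n1)
    have "(a 0 + b 0) * (LBINT s=0..t0. (vt t0 * even_part ut s - ut t0 * odd_part vt s) / cross_det ut vt s) = 1"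
      by (rule first_order_integral_eq_1[OF du dv det t0])
    then have L: "reflection_op n a b (derivs vt) 0 = 0"
      using alternatives t0 by (auto simp: n1 cross_det_def)
    have "a 0 * vt 0 = 0"
      using L reflection_factor_first_order[OF V n an bn, of 0] an bn
      by (simp add: n1 reflection_op_def algebra_simps)
    then have a0: "a 0 = 0" using det[of 0] by (auto simp: cross_det_eq)
    have "((\<lambda>t. exp (b 0 * t) * ut t) has_real_derivative 0) (at t)" for t
      by (rule derivative_eq_intros du refl)+ (simp add: a0 algebra_simps)
    then have "exp (b 0 * 0) * ut 0 = exp (b 0 * t0) * ut t0"
      using DERIV_isconst_all[of "\<lambda>t. exp (b 0 * t) * ut t" 0 t0] by simp
    then show False using t0 det[of 0] by (simp add: cross_det_eq)
  qed
  then show ?thesis by (rule problem_solvable[OF n h an bn U V det])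
qed

end
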